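(* Let $H$ be an infinite-dimensional separable Hilbert space, let $A\in\mathcal B(H)$ be a positive operator, let $I$ be a finite index set, and let $\{f_i\}_{i\in I}\subset H$. Suppose that $\mathcal A:=\{A^nf_i\}_{n\in\mathbb N,\,i\in I}$ is a frame for $H$. Then, for every $q\in\mathbb N^+$, the subfamily $\mathcal A_q:=\{A^{qn}f_i\}_{n\in\mathbb N,\,i\in I}$ is also a frame for $H$. In particular, $\mathcal A$ has infinite excess. In addition, if $A$ is invertible, then the frame property is preserved after the removal of any finite collection of elements of $\mathcal A$; that is, for every finite $J\subset\mathbb N\times I$, the family $\{A^nf_i:(n,i)\in(\mathbb N\times I)\setminus J\}$ is a frame for $H$.
   Context: $\mathbb N=\{0,1,2,\dots\}$, $\mathbb N^+=\mathbb N\setminus\{0\}$. $H$ is a complex Hilbert space and $\mathcal B(H)$ is the algebra of bounded linear operators on $H$. Positive means $A$ is self-adjoint with $\langle Ax,x\rangle\ge0$ for all $x\in H$; $A^0=I_H$; invertible means having a bounded inverse. A family $\{f_\gamma\}_{\gamma\in G}$ (indexed by a countable set $G$, repetitions allowed) is a frame for $H$ if there are constants $0<a\le b<\infty$ with $a\|x\|^2\le\sum_{\gamma\in G}|\langle x,f_\gamma\rangle|^2\le b\|x\|^2$ for all $x\in H$. The excess of a frame is the supremum of the numbers of elements (counted by index) that can be removed from it so that the remaining family is still complete (has dense linear span) in $H$; infinite excess means that this supremum is $\infty$. *)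

theory Defs
  imports "HOL-Analysis.Analysis"
begin

text \<open>
  Complex Hilbert spaces. The inner product is linear in its first argument. The underlying real
  structure (\<open>scaleR\<close>, \<open>inner\<close>, \<open>norm\<close>, topology) is required to be the one induced by the complex
  structure, so that the library's real analysis applies; in particular
  \<open>norm x = sqrt (Re (cinner x x))\<close>.
\<close>

class complex_inner = real_inner +
  fixes scaleC :: "complex \<Rightarrow> 'a \<Rightarrow> 'a"  (infixr \<open>*\<^sub>C\<close> 75)
    and cinner :: "'a \<Rightarrow> 'a \<Rightarrow> complex"
  assumes scaleC_add_right: "c *\<^sub>C (x + y) = c *\<^sub>C x + c *\<^sub>C y"
    and scaleC_add_left: "(c + d) *\<^sub>C x = c *\<^sub>C x + d *\<^sub>C x"
    and scaleC_scaleC: "c *\<^sub>C d *\<^sub>C x = (c * d) *\<^sub>C x"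
    and scaleC_one: "1 *\<^sub>C x = x"
    and scaleR_scaleC: "r *\<^sub>R x = complex_of_real r *\<^sub>C x"
    and cinner_commute: "cinner x y = cnj (cinner y x)"
    and cinner_add_left: "cinner (x + y) z = cinner x z + cinner y z"
    and cinner_scaleC_left: "cinner (c *\<^sub>C x) y = c * cinner x y"
    and inner_eq_Re_cinner: "inner x y = Re (cinner x y)"

class complex_hilbert_space = complex_inner + complete_space

instantiation complex :: complex_hilbert_space
begin

definition scaleC_complex :: "complex \<Rightarrow> complex \<Rightarrow> complex"
  where "scaleC_complex c x = c * x"

definition cinner_complex :: "complex \<Rightarrow> complex \<Rightarrow> complex"
  where "cinner_complex x y = x * cnj y"

instance
  by standard
    (simp_all add: scaleC_complex_def cinner_complex_def algebra_simps scaleR_conv_of_real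
      inner_complex_def)

end

global_interpretation complex_vector:
  vector_space "scaleC :: complex \<Rightarrow> 'a \<Rightarrow> 'a::complex_inner"
  defines cspan = complex_vector.span
  by standard (simp_all add: scaleC_add_right scaleC_add_left scaleC_scaleC scaleC_one)

definition infinite_dimensional :: "'a::complex_inner itself \<Rightarrow> bool"
  where "infinite_dimensional _ \<longleftrightarrow> \<not> (\<exists>B::'a set. finite B \<and> cspan B = UNIV)"


definition bounded_clinear :: "('a::complex_inner \<Rightarrow> 'b::complex_inner) \<Rightarrow> bool"
  where "bounded_clinear A \<longleftrightarrow> bounded_linear A \<and> (\<forall>c x. A (c *\<^sub>C x) = c *\<^sub>C A x)"

definition self_adjoint :: "('a::complex_inner \<Rightarrow> 'a) \<Rightarrow> bool"
  where "self_adjoint A \<longleftrightarrow> (\<forall>x y. cinner (A x) y = cinner x (A y))"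

definition positive_op :: "('a::complex_inner \<Rightarrow> 'a) \<Rightarrow> bool"
  where "positive_op A \<longleftrightarrow>
    bounded_clinear A \<and> self_adjoint A \<and> (\<forall>x. cinner (A x) x \<in> \<real>\<^sub>\<ge>\<^sub>0)"

definition invertible_op :: "('a::complex_inner \<Rightarrow> 'a) \<Rightarrow> bool"
  where "invertible_op A \<longleftrightarrow> (\<exists>B. bounded_clinear B \<and> A \<circ> B = id \<and> B \<circ> A = id)"


text \<open>
  A family is a function together with its index set, so repeated vectors are counted by index.
  The summability conjunct is the finiteness of the sum: \<open>infsum\<close> of a non-summable function is
  \<open>0\<close>.
\<close>

definition is_frame :: "'g set \<Rightarrow> ('g \<Rightarrow> 'a::complex_inner) \<Rightarrow> bool"
  where "is_frame G f \<longleftrightarrow> countable G \<and>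
    (\<exists>a b::real. 0 < a \<and> a \<le> b \<and>
      (\<forall>x. (\<lambda>g. (cmod (cinner x (f g)))\<^sup>2) summable_on G \<and>
           a * (norm x)\<^sup>2 \<le> (\<Sum>\<^sub>\<infinity>g\<in>G. (cmod (cinner x (f g)))\<^sup>2) \<and>
           (\<Sum>\<^sub>\<infinity>g\<in>G. (cmod (cinner x (f g)))\<^sup>2) \<le> b * (norm x)\<^sup>2))"

definition is_complete_family :: "'g set \<Rightarrow> ('g \<Rightarrow> 'a::complex_inner) \<Rightarrow> bool"
  where "is_complete_family G f \<longleftrightarrow> closure (cspan (f ` G)) = UNIV"

definition ecard :: "'g set \<Rightarrow> enat"
  where "ecard J = (if finite J then enat (card J) else \<infinity>)"

definition excess :: "'g set \<Rightarrow> ('g \<Rightarrow> 'a::complex_inner) \<Rightarrow> enat"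
  where "excess G f = (SUP J \<in> {J. J \<subseteq> G \<and> is_complete_family (G - J) f}. ecard J)"

end

theory Submission
  imports Defs "HOL-Computational_Algebra.Fundamental_Theorem_Algebra"
begin

text \<open>
  Let \<open>E_q(x)\<close> be the sum of the squares \<open>|\<langle>x, A^(q n) f_i\<rangle>|\<^sup>2\<close>. Sorting exponents by their residue
  modulo \<open>q\<close> gives \<open>E_1(x) = E_q(x) + E_q(A x) + \<dots> + E_q(A^(q-1) x)\<close>
  (\<open>coeff_energy_orbit_residues\<close>), so a lower bound for \<open>E_q\<close> follows from the one for \<open>E_1\<close> once
  \<open>E_q(A^r x)\<close> is controlled by \<open>E_q(x)\<close>. For \<open>A^q\<close> in place of \<open>A^r\<close> this is immediate:
  \<open>E_q(A^q x)\<close> is a tail of the sum \<open>E_q(x)\<close>. Positivity enters because it makes \<open>A\<close> the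
  positive \<open>q\<close>-th root of \<open>A^q\<close>, hence a limit in operator norm of polynomials in \<open>A^q\<close>
  (\<open>positive_op_approx_by_poly_of_power\<close>). This yields, for each \<open>\<epsilon> > 0\<close>, a bound
  \<open>E_q(A^r x) \<le> C E_q(x) + \<epsilon> \<parallel>x\<parallel>\<^sup>2\<close> (\<open>coeff_energy_power_estimate\<close>), and a small enough error is
  absorbed by the lower frame bound.

  The norm approximation comes from the Weierstrass theorem and the inequality
  \<open>\<parallel>g(A)\<parallel> \<le> sup |g|\<close> over \<open>[0, M]\<close> with \<open>M \<ge> \<parallel>A\<parallel>\<close>, for real polynomials \<open>g\<close>
  (\<open>norm_poly_op_le\<close>). It is obtained without a spectral theorem: a complex polynomial without
  zeros on \<open>[0, M]\<close> splits into linear factors \<open>A - z\<close>, each bounded below, and \<open>g(A)\<^sup>2 - L\<^sup>2\<close> with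
  \<open>L = \<parallel>g(A)\<parallel> > 0\<close> is not bounded below.

  The excess is infinite because the even powers alone already form a frame, and a frame is complete.
  For invertible \<open>A\<close> a tail of the orbits, seen from \<open>x\<close>, is the whole family seen from \<open>A^N x\<close>,
  whose norm is at least a constant times that of \<open>x\<close>.
\<close>

section \<open>Complex inner products\<close>

lemma scaleC_zero_left [simp]: "0 *\<^sub>C (x::'a::complex_inner) = 0"
  using scaleR_scaleC[of 0 x] by simp

lemma scaleC_of_real: "complex_of_real r *\<^sub>C (x::'a::complex_inner) = r *\<^sub>R x"
  by (simp add: scaleR_scaleC)

lemma cinner_scaleC_right: "cinner x (c *\<^sub>C y) = cnj c * cinner x y"
  by (subst (1 2) cinner_commute) (simp add: cinner_scaleC_left)

lemma cinner_minus_left: "cinner (x - y) z = cinner x z - cinner y z"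
  using cinner_add_left[of "x - y" y z] by simp

lemma cinner_self: "cinner x x = complex_of_real ((norm x)\<^sup>2)"
proof (rule complex_eqI)
  show "Re (cinner x x) = Re (complex_of_real ((norm x)\<^sup>2))"
    by (simp flip: inner_eq_Re_cinner power2_norm_eq_inner)
  have "Im (cinner x x) = - Im (cinner x x)"
    by (subst cinner_commute) simp
  then show "Im (cinner x x) = Im (complex_of_real ((norm x)\<^sup>2))" by simp
qed

lemma norm_scaleC: "norm (c *\<^sub>C (x::'a::complex_inner)) = cmod c * norm x"
proof (rule power2_eq_imp_eq)
  have "complex_of_real ((norm (c *\<^sub>C x))\<^sup>2) = (c * cnj c) * cinner x x"
    unfolding cinner_self [symmetric] by (simp add: cinner_scaleC_left cinner_scaleC_right)
  also have "\<dots> = complex_of_real ((cmod c * norm x)\<^sup>2)"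
    unfolding cinner_self complex_norm_square [symmetric] power_mult_distrib of_real_mult ..
  finally show "(norm (c *\<^sub>C x))\<^sup>2 = (cmod c * norm x)\<^sup>2"
    by (simp only: of_real_eq_iff)
qed auto

text \<open>
  The complex Cauchy--Schwarz inequality is the real one after rotating \<open>x\<close> by a phase that makes
  the inner product real and nonnegative.
\<close>

lemma cmod_cinner_le: "cmod (cinner x y) \<le> norm x * norm y"
proof (cases "cinner x y = 0")
  case False
  define c where "c = cnj (cinner x y) / of_real (cmod (cinner x y))"
  have c: "cmod c = 1"
    using False by (simp add: c_def norm_divide)
  have "c * cinner x y = of_real (cmod (cinner x y))"
    using False by (simp add: c_def mult.commute[of "cnj _"] power2_eq_square flip: complex_norm_square)
  then have "cmod (cinner x y) = inner (c *\<^sub>C x) y"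
    by (simp add: inner_eq_Re_cinner cinner_scaleC_left)
  also have "\<dots> \<le> norm (c *\<^sub>C x) * norm y"
    by (rule norm_cauchy_schwarz)
  finally show ?thesis by (simp add: norm_scaleC c)
qed simp

section \<open>Polynomials of a positive operator\<close>

text \<open>
  Horner's scheme, as for \<open>poly\<close>: the resulting recursion over \<open>pCons\<close> turns the algebraic laws
  of the functional calculus into inductions over polynomials.
\<close>

definition poly_op :: "complex poly \<Rightarrow> ('a::complex_inner \<Rightarrow> 'a) \<Rightarrow> 'a \<Rightarrow> 'a"
  where "poly_op p A = fold_coeffs (\<lambda>c B x. c *\<^sub>C x + A (B x)) p (\<lambda>_. 0)"

lemma bounded_clinear_linear: "bounded_clinear A \<Longrightarrow> linear A"
  by (simp add: bounded_clinear_def bounded_linear.linear)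

lemma poly_op_0 [simp]: "poly_op 0 A x = 0"
  by (simp add: poly_op_def)

lemma poly_op_pCons:
  assumes "bounded_clinear A"
  shows "poly_op (pCons c p) A x = c *\<^sub>C x + A (poly_op p A x)"
proof (cases "c = 0 \<and> p = 0")
  case True
  then show ?thesis
    using linear_0[OF bounded_clinear_linear[OF assms]] by simp
next
  case False
  then show ?thesis by (auto simp: poly_op_def)
qed

lemma bounded_linear_poly_op:
  assumes "bounded_clinear A"
  shows "bounded_linear (poly_op p A)"
proof (induction p)
  case 0
  have "poly_op 0 A = (\<lambda>_. 0)" by (rule ext) simp
  then show ?case by simp
next
  case (pCons c p)
  have "bounded_linear (\<lambda>x::'a. c *\<^sub>C x)"
    by (rule bounded_linear_intro[where K = "cmod c"])
      (auto simp: scaleC_add_right norm_scaleC scaleR_scaleC scaleC_scaleC mult.commute)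
  moreover have "bounded_linear (\<lambda>x. A (poly_op p A x))"
    using pCons.IH assms by (auto simp: bounded_clinear_def intro: bounded_linear_compose)
  ultimately have "bounded_linear (\<lambda>x. c *\<^sub>C x + A (poly_op p A x))"
    by (rule bounded_linear_add)
  also have "(\<lambda>x. c *\<^sub>C x + A (poly_op p A x)) = poly_op (pCons c p) A"
    by (rule ext) (simp add: poly_op_pCons[OF assms])
  finally show ?case .
qed

lemma poly_op_add:
  assumes "bounded_clinear A"
  shows "poly_op (p + q) A x = poly_op p A x + poly_op q A x"
  using linear_add[OF bounded_clinear_linear[OF assms]]
  by (induction p q rule: poly_induct2) (simp_all add: poly_op_pCons[OF assms] scaleC_add_left)

lemma poly_op_smult:
  assumes "bounded_clinear A"
  shows "poly_op (smult c p) A x = c *\<^sub>C poly_op p A x"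
  using assms
  by (induction p) (simp_all add: poly_op_pCons scaleC_add_right scaleC_scaleC bounded_clinear_def)

lemma poly_op_mult:
  assumes "bounded_clinear A"
  shows "poly_op (p * q) A x = poly_op p A (poly_op q A x)"
  by (induction p) (simp_all add: poly_op_pCons[OF assms] poly_op_add[OF assms] poly_op_smult[OF assms])

lemma poly_op_commute:
  assumes "bounded_clinear A"
  shows "A (poly_op p A x) = poly_op p A (A x)"
proof -
  have A: "poly_op [:0, 1:] A y = A y" for y
    by (simp add: poly_op_pCons[OF assms] scaleC_one linear_0[OF bounded_clinear_linear[OF assms]])
  have "poly_op ([:0, 1:] * p) A x = poly_op (p * [:0, 1:]) A x"
    by (simp only: mult.commute)
  then show ?thesis unfolding poly_op_mult[OF assms] A .
qed

lemma poly_op_monom: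
  assumes "bounded_clinear A"
  shows "poly_op (monom c n) A x = c *\<^sub>C (A ^^ n) x"
  using assms linear_0[OF bounded_clinear_linear[OF assms]]
  by (induction n) (simp_all add: monom_0 monom_Suc poly_op_pCons[OF assms] bounded_clinear_def)

lemma poly_op_sum:
  assumes "bounded_clinear A"
  shows "poly_op (\<Sum>i\<in>K. p i) A x = (\<Sum>i\<in>K. poly_op (p i) A x)"
  by (induction K rule: infinite_finite_induct) (simp_all add: poly_op_add[OF assms])

lemma inner_poly_op_real:
  assumes A: "bounded_clinear A" "self_adjoint A"
  shows "inner (poly_op (map_poly complex_of_real g) A x) y
       = inner x (poly_op (map_poly complex_of_real g) A y)"
proof (induction g arbitrary: x y)
  case (pCons c g)
  have "inner (A u) v = inner u (A v)" for u v
    using A(2) by (simp add: self_adjoint_def inner_eq_Re_cinner)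
  then show ?case
    by (simp add: map_poly_pCons poly_op_pCons[OF A(1)] scaleC_of_real inner_add_left
        inner_add_right pCons.IH poly_op_commute[OF A(1)])
qed simp
text \<open>
  For a unit vector \<open>x\<close> the number \<open>\<langle>A x, x\<rangle>\<close> lies in \<open>[0, M]\<close>, so
  \<open>\<langle>(A - z) x, x\<rangle> = \<langle>A x, x\<rangle> - z\<close> has modulus at least the distance from \<open>z\<close> to \<open>[0, M]\<close>.
\<close>

lemma positive_op_minus_scalar_bounded_below:
  assumes A: "positive_op A" and M: "\<And>x. norm (A x) \<le> M * norm x"
    and z: "z \<notin> complex_of_real ` {0..M}"
  shows "\<exists>c>0. \<forall>x. c * norm x \<le> norm (A x - z *\<^sub>C x)"
proof (cases "{0..M} = {}")
  case True
  then have "norm x = 0" for x :: 'a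
    using order_trans[OF norm_ge_zero M[of x]] by (auto simp: zero_le_mult_iff)
  then have "1 * norm x \<le> norm (A x - z *\<^sub>C x)" for x
    by (metis mult_1 norm_ge_zero)
  then show ?thesis using zero_less_one by blast
next
  case False
  define S where "S = complex_of_real ` {0..M}"
  have "closed S"
    unfolding S_def by (intro compact_imp_closed compact_continuous_image continuous_intros) auto
  define d where "d = infdist z S"
  have "S \<noteq> {}" using False by (simp add: S_def)
  then have d: "d > 0"
    using infdist_pos_not_in_closed[OF \<open>closed S\<close>] z by (simp add: d_def S_def)
  have "d * norm x \<le> norm (A x - z *\<^sub>C x)" for x
  proof (cases "x = 0")
    case False
    then have nx: "norm x > 0" by simp
    obtain s where s: "cinner (A x) x = complex_of_real s" "s \<ge> 0"
      using A unfolding positive_op_def nonneg_Reals_def by auto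
    define t where "t = s / (norm x)\<^sup>2"
    have "s \<le> norm (A x) * norm x"
      using cmod_cinner_le[of "A x" x] s by simp
    also have "\<dots> \<le> M * (norm x)\<^sup>2"
      using mult_right_mono[OF M[of x], of "norm x"] by (simp add: power2_eq_square mult.assoc)
    finally have "t \<in> {0..M}"
      using s(2) nx by (simp add: t_def pos_divide_le_eq)
    then have "complex_of_real t \<in> S"
      unfolding S_def by (rule imageI)
    then have "d \<le> cmod (of_real t - z)"
      unfolding d_def by (metis infdist_le dist_commute dist_norm)
    then have "d * (norm x)\<^sup>2 \<le> cmod (of_real t - z) * (norm x)\<^sup>2"
      by (simp add: mult_right_mono)
    also have "\<dots> = cmod ((of_real t - z) * of_real ((norm x)\<^sup>2))"
      by (simp add: norm_mult norm_power)
    also have "(of_real t - z) * of_real ((norm x)\<^sup>2) = cinner (A x - z *\<^sub>C x) x"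
      using nx by (simp add: cinner_minus_left cinner_scaleC_left cinner_self s t_def left_diff_distrib)
    also have "cmod \<dots> \<le> norm (A x - z *\<^sub>C x) * norm x"
      by (rule cmod_cinner_le)
    finally show ?thesis
      using nx by (simp add: power2_eq_square)
  qed simp
  then show ?thesis using d by blast
qed

text \<open>
  One half of the spectral mapping theorem: by the fundamental theorem of algebra \<open>p(A)\<close> is a
  product of factors \<open>A - z\<close> over the roots \<open>z\<close> of \<open>p\<close>, and each of them is bounded below.
\<close>

lemma poly_op_bounded_below:
  assumes A: "positive_op A" and M: "\<And>x. norm (A x) \<le> M * norm x"
    and p: "\<And>t. t \<in> {0..M} \<Longrightarrow> poly p (complex_of_real t) \<noteq> 0" "p \<noteq> 0"
  shows "\<exists>c>0. \<forall>x. c * norm x \<le> norm (poly_op p A x)"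
  using p
proof (induction "degree p" arbitrary: p)
  case 0
  then obtain a where a: "p = [:a:]" "a \<noteq> 0"
    by (metis degree_eq_zeroE pCons_0_0)
  have "bounded_clinear A" using A by (simp add: positive_op_def)
  then have "poly_op p A x = a *\<^sub>C x" for x
    by (simp add: a poly_op_pCons linear_0[OF bounded_clinear_linear])
  then show ?case
    using a by (intro exI[of _ "cmod a"]) (simp add: norm_scaleC)
next
  case (Suc n)
  have lin: "bounded_clinear A" using A by (simp add: positive_op_def)
  have "\<not> constant (poly p)"
    using Suc.hyps(2) constant_degree[of p] by simp
  then obtain z where z: "poly p z = 0"
    using fundamental_theorem_of_algebra by blast
  then obtain r where r: "p = [:-z, 1:] * r"
    by (metis dvdE poly_eq_0_iff_dvd)
  have "r \<noteq> 0" using r Suc.prems(2) by auto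
  then have "degree p = Suc (degree r)"
    unfolding r by (subst degree_mult_eq) auto
  then have "n = degree r" using Suc.hyps(2) by simp
  moreover have "poly r (complex_of_real t) \<noteq> 0" if "t \<in> {0..M}" for t
    using Suc.prems(1)[OF that] r by auto
  ultimately obtain c where c: "c > 0" "\<And>x. c * norm x \<le> norm (poly_op r A x)"
    using Suc.hyps(1)[of r] \<open>r \<noteq> 0\<close> by blast
  have "z \<notin> complex_of_real ` {0..M}"
    using Suc.prems(1) z by auto
  then obtain d where d: "d > 0" "\<And>x. d * norm x \<le> norm (A x - z *\<^sub>C x)"
    using positive_op_minus_scalar_bounded_below[OF A M] by blast
  have lf: "poly_op [:-z, 1:] A y = A y - z *\<^sub>C y" for y
  proof -
    have "(-z) *\<^sub>C y + z *\<^sub>C y = 0"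
      using scaleC_add_left[of "-z" z y] by simp
    then show ?thesis
      by (simp add: poly_op_pCons[OF lin] scaleC_one linear_0[OF bounded_clinear_linear[OF lin]]
          eq_diff_eq add.commute add.left_commute)
  qed
  have "d * c * norm x \<le> norm (poly_op p A x)" for x
  proof -
    have "d * c * norm x \<le> d * norm (poly_op r A x)"
      using c(2)[of x] d(1) by (simp add: mult.assoc)
    also have "\<dots> \<le> norm (poly_op p A x)"
      unfolding r poly_op_mult[OF lin] lf by (rule d(2))
    finally show ?thesis .
  qed
  then show ?case using c(1) d(1) by (intro exI[of _ "d * c"]) auto
qed

lemma poly_map_of_real:
  "poly (map_poly complex_of_real g) (complex_of_real t) = complex_of_real (poly g t)"
  by (induction g) (simp_all add: map_poly_pCons)

text \<open>
  If \<open>L = \<parallel>p(A)\<parallel>\<close> exceeded \<open>K\<close>, then \<open>p\<^sup>2 - L\<^sup>2\<close> would have no zero on \<open>[0, M]\<close>, so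
  \<open>p(A)\<^sup>2 - L\<^sup>2\<close> would be bounded below. This is impossible because \<open>p(A)\<close> is symmetric: expanding
  the square shows that \<open>p(A)\<^sup>2 x - L\<^sup>2 x\<close> is small for every unit vector \<open>x\<close> at which \<open>p(A)\<close>
  nearly attains its norm.
\<close>

lemma norm_poly_op_le:
  assumes A: "positive_op A" and M: "M \<ge> 0" "\<And>x. norm (A x) \<le> M * norm x"
    and K: "\<And>t. t \<in> {0..M} \<Longrightarrow> \<bar>poly g t\<bar> \<le> K"
  shows "norm (poly_op (map_poly complex_of_real g) A x) \<le> K * norm x"
proof -
  define p where "p = map_poly complex_of_real g"
  define B where "B = poly_op p A"
  define L where "L = onorm B"
  have lin: "bounded_clinear A" and sa: "self_adjoint A"
    using A by (simp_all add: positive_op_def)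
  have bl: "bounded_linear B"
    unfolding B_def using lin by (rule bounded_linear_poly_op)
  have sym: "inner (B x) y = inner x (B y)" for x y
    unfolding B_def p_def using lin sa by (rule inner_poly_op_real)
  have le: "norm (B x) \<le> L * norm x" for x
    unfolding L_def by (rule onorm[OF bl])
  have K0: "K \<ge> 0"
    using K[of 0] M(1) by simp
  have "L \<le> K"
  proof (rule ccontr)
    assume "\<not> L \<le> K"
    then have LK: "L > K" and L0: "L > 0" using K0 by auto
    define s where "s = p * p - [:complex_of_real (L\<^sup>2):]"
    have nz: "poly s (complex_of_real t) \<noteq> 0" if "t \<in> {0..M}" for t
    proof -
      have "(poly g t)\<^sup>2 < L\<^sup>2"
        using power_mono[OF K[OF that] abs_ge_zero, of 2] power_strict_mono[OF LK K0, of 2] by simp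
      moreover have "poly s (complex_of_real t) = complex_of_real ((poly g t)\<^sup>2 - L\<^sup>2)"
        by (simp add: s_def p_def poly_map_of_real power2_eq_square)
      ultimately show ?thesis by (metis diff_eq_eq less_irrefl of_real_eq_0_iff add_0)
    qed
    have "s \<noteq> 0" using nz[of 0] M(1) by auto
    then obtain c where c: "c > 0" "\<And>x. c * norm x \<le> norm (poly_op s A x)"
      using poly_op_bounded_below[OF A M(2) nz] by blast
    have sA: "poly_op s A x = B (B x) - L\<^sup>2 *\<^sub>R x" for x
    proof -
      have "s = p * p + [:complex_of_real (- L\<^sup>2):]"
        by (simp add: s_def)
      then have "poly_op s A x = B (B x) + complex_of_real (- L\<^sup>2) *\<^sub>C x"
        by (simp only: poly_op_add[OF lin] poly_op_mult[OF lin] B_def poly_op_pCons[OF lin] poly_op_0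
            linear_0[OF bounded_clinear_linear[OF lin]] add_0_right)
      then show ?thesis by (simp only: scaleC_of_real) simp
    qed
    \<comment> \<open>A bound for \<open>B\<^sup>2\<close> that is strictly smaller than \<open>L\<^sup>2\<close>.\<close>
    define r where "r = L\<^sup>2 - (c / L)\<^sup>2"
    have Bx: "(norm (B x))\<^sup>2 \<le> r * (norm x)\<^sup>2" for x
    proof -
      have "c\<^sup>2 * (norm x)\<^sup>2 \<le> (norm (B (B x) - L\<^sup>2 *\<^sub>R x))\<^sup>2"
        using power_mono[OF c(2)[of x], of 2] c(1) by (simp add: sA power_mult_distrib)
      also have "\<dots> = (norm (B (B x)))\<^sup>2 - 2 * L\<^sup>2 * (norm (B x))\<^sup>2 + L^4 * (norm x)\<^sup>2"
        using sym[of "B x" x] unfolding power2_norm_eq_inner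
        by (simp add: inner_diff_left inner_diff_right inner_commute
            power4_eq_xxxx power2_eq_square algebra_simps)
      also have "(norm (B (B x)))\<^sup>2 \<le> L\<^sup>2 * (norm (B x))\<^sup>2"
        using power_mono[OF le[of "B x"], of 2] by (simp add: power_mult_distrib)
      finally have "L\<^sup>2 * (norm (B x))\<^sup>2 \<le> (L^4 - c\<^sup>2) * (norm x)\<^sup>2"
        by (simp add: algebra_simps)
      moreover have "L^4 - c\<^sup>2 = L\<^sup>2 * r"
        using L0 by (simp add: r_def power_divide right_diff_distrib flip: power_add)
      ultimately show ?thesis
        using L0 by (simp add: mult.assoc)
    qed
    \<comment> \<open>The number \<open>r\<close> could be negative a priori, whereas a norm bound must be nonnegative.\<close>
    have "norm (B x) \<le> sqrt (max r 0) * norm x" for x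
    proof -
      have "(norm (B x))\<^sup>2 \<le> max r 0 * (norm x)\<^sup>2"
        using Bx[of x] mult_right_mono[of r "max r 0" "(norm x)\<^sup>2"] by simp
      then show ?thesis
        using real_sqrt_le_mono by (fastforce simp: real_sqrt_mult)
    qed
    then have "L \<le> sqrt (max r 0)"
      unfolding L_def by (intro onorm_bound) auto
    then have "L\<^sup>2 \<le> max r 0"
      using L0 real_sqrt_le_iff[of "L\<^sup>2" "max r 0"] by simp
    moreover have "L\<^sup>2 > 0" using L0 by simp
    moreover have "r < L\<^sup>2" using c(1) L0 by (simp add: r_def)
    ultimately show False by linarith
  qed
  then show ?thesis
    using le[of x] mult_right_mono[of L K "norm x"] by (simp add: B_def p_def)
qed

text \<open>
  The continuous function \<open>t = root q (t^q)\<close> on \<open>[0, M]\<close> is a uniform limit of polynomials in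
  \<open>t^q\<close>, by the Weierstrass theorem applied to \<open>root q\<close> on \<open>[0, M^q]\<close>.
\<close>

lemma positive_op_approx_by_poly_of_power:
  assumes A: "positive_op A" and q: "q > 0" and e: "e > 0"
  obtains a :: "nat \<Rightarrow> real" and n
  where "\<And>x. norm (A x - (\<Sum>i\<le>n. a i *\<^sub>R (A ^^ (q * i)) x)) \<le> e * norm x"
proof -
  have lin: "bounded_clinear A"
    using A by (simp add: positive_op_def)
  then obtain M where M: "M > 0" "\<And>x. norm (A x) \<le> M * norm x"
    using bounded_linear.pos_bounded[of A] by (auto simp: bounded_clinear_def mult.commute)
  obtain h where h: "real_polynomial_function h"
      "\<And>s. s \<in> {0..M^q} \<Longrightarrow> \<bar>root q s - h s\<bar> < e"
    by (rule Stone_Weierstrass_real_polynomial_function[of "{0..M^q}" "root q" e])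
      (use e in \<open>auto intro!: continuous_intros\<close>)
  obtain a n where an: "h = (\<lambda>s. \<Sum>i\<le>n. a i * s^i)"
    using h(1) real_polynomial_function_iff_sum by auto
  define g where "g = monom 1 1 + (\<Sum>i\<le>n. monom (- a i) (q * i))"
  have "\<bar>poly g t\<bar> \<le> e" if "t \<in> {0..M}" for t
  proof -
    have "poly g t = root q (t^q) - h (t^q)"
      using that q by (simp add: g_def an poly_sum poly_monom sum_negf power_mult real_root_power_cancel)
    moreover have "t^q \<in> {0..M^q}"
      using that by (auto intro: power_mono)
    ultimately show ?thesis using h(2)[of "t^q"] by simp
  qed
  then have *: "norm (poly_op (map_poly complex_of_real g) A x) \<le> e * norm x" for x
    using norm_poly_op_le[OF A _ M(2)] M(1) by (simp add: less_imp_le)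
  have g: "map_poly complex_of_real g
      = monom 1 1 + (\<Sum>i\<le>n. monom (complex_of_real (- a i)) (q * i))"
    by (rule poly_eqI) (auto simp: g_def coeff_map_poly coeff_sum intro!: sum.cong)
  have "poly_op (map_poly complex_of_real g) A x = A x - (\<Sum>i\<le>n. a i *\<^sub>R (A ^^ (q * i)) x)" for x
    unfolding g by (simp only: poly_op_add[OF lin] poly_op_sum[OF lin] poly_op_monom[OF lin]
        scaleC_one scaleC_of_real) (simp add: sum_negf)
  then show ?thesis using * that by metis
qed
section \<open>Orthogonal vectors and completeness of frames\<close>

text \<open>
  The orthogonal vector is \<open>x - v\<close>, where \<open>x\<close> lies outside the subspace and \<open>v\<close> is its nearest
  point there; by the parallelogram law every minimizing sequence is a Cauchy sequence.
\<close>

lemma closed_subspace_orthogonal_vector: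
  fixes V :: "'a::{real_inner, complete_space} set"
  assumes V: "closed V" and zero: "0 \<in> V"
    and add: "\<And>x y. x \<in> V \<Longrightarrow> y \<in> V \<Longrightarrow> x + y \<in> V"
    and scale: "\<And>r x. x \<in> V \<Longrightarrow> r *\<^sub>R x \<in> V"
    and x: "x \<notin> V"
  obtains y where "y \<noteq> 0" "\<And>v. v \<in> V \<Longrightarrow> inner y v = 0"
proof -
  define d where "d = infdist x V"
  have ne: "V \<noteq> {}" using zero by auto
  have d: "d > 0"
    unfolding d_def using V ne x by (rule infdist_pos_not_in_closed)
  have dle: "d \<le> norm (x - v)" if "v \<in> V" for v
    using infdist_le[OF that, of x] by (simp add: d_def dist_norm)
  have "\<exists>v\<in>V. norm (x - v) < d + 1 / real (Suc n)" for n
  proof -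
    have "bdd_below (dist x ` V)" by (auto intro!: bdd_belowI[of _ 0])
    moreover have "(INF v\<in>V. dist x v) < d + 1 / real (Suc n)"
      using ne by (simp add: d_def infdist_notempty)
    ultimately show ?thesis
      using cINF_less_iff[of V "dist x"] ne by (simp add: dist_norm)
  qed
  then obtain w where w: "\<And>n. w n \<in> V" "\<And>n. norm (x - w n) < d + 1 / real (Suc n)"
    by metis
  have w2: "(norm (x - w n))\<^sup>2 \<le> d\<^sup>2 + (2 * d + 1) / real (Suc N)" if "N \<le> n" for n N
  proof -
    have "norm (x - w n) \<le> d + 1 / real (Suc N)"
    proof -
      have "1 / real (Suc n) \<le> 1 / real (Suc N)"
        using that by (intro divide_left_mono) auto
      then show ?thesis using w(2)[of n] by linarith
    qed
    then have "(norm (x - w n))\<^sup>2 \<le> (d + 1 / real (Suc N))\<^sup>2"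
      by (rule power_mono) simp
    also have "\<dots> = d\<^sup>2 + 2 * d * (1 / real (Suc N)) + (1 / real (Suc N)) * (1 / real (Suc N))"
      by (simp only: power2_sum) (simp add: power2_eq_square)
    also have "(1 / real (Suc N)) * (1 / real (Suc N)) \<le> 1 * (1 / real (Suc N))"
      by (rule mult_right_mono) (simp_all add: divide_simps)
    finally show ?thesis by (simp add: add_divide_distrib)
  qed
  have par: "(norm (w m - w n))\<^sup>2 \<le> 4 * (2 * d + 1) / real (Suc N)" if "N \<le> m" "N \<le> n" for m n N
  proof -
    have "(1/2) *\<^sub>R (w m + w n) \<in> V"
      using w(1) add scale by blast
    then have "d \<le> norm (x - (1/2) *\<^sub>R (w m + w n))"
      by (rule dle)
    then have "(2 * d)\<^sup>2 \<le> (2 * norm (x - (1/2) *\<^sub>R (w m + w n)))\<^sup>2"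
      using d by (intro power_mono) auto
    also have "2 * norm (x - (1/2) *\<^sub>R (w m + w n)) = norm ((x - w m) + (x - w n))"
    proof -
      have "(x - w m) + (x - w n) = 2 *\<^sub>R (x - (1/2) *\<^sub>R (w m + w n))"
        by (simp add: scaleR_diff_right scaleR_2 algebra_simps)
      then show ?thesis by simp
    qed
    finally have "4 * d\<^sup>2 \<le> (norm ((x - w m) + (x - w n)))\<^sup>2"
      by (simp add: power_mult_distrib)
    moreover have "(norm ((x - w m) + (x - w n)))\<^sup>2 + (norm (w m - w n))\<^sup>2
        = 2 * (norm (x - w m))\<^sup>2 + 2 * (norm (x - w n))\<^sup>2"
      by (simp add: power2_norm_eq_inner inner_add_left inner_add_right inner_diff_left
          inner_diff_right inner_commute)
    ultimately have "(norm (w m - w n))\<^sup>2 \<le> 4 * ((2 * d + 1) / real (Suc N))"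
      using w2[OF that(1)] w2[OF that(2)] by linarith
    then show ?thesis by (simp only: times_divide_eq_right)
  qed
  have "Cauchy w"
  proof (rule metric_CauchyI)
    fix e :: real assume e: "e > 0"
    obtain N where "4 * (2 * d + 1) / e\<^sup>2 < real N"
      using reals_Archimedean2 by blast
    then have "4 * (2 * d + 1) < e\<^sup>2 * real (Suc N)"
    proof -
      have "4 * (2 * d + 1) < real N * e\<^sup>2"
        using \<open>4 * (2 * d + 1) / e\<^sup>2 < real N\<close> e by (simp add: pos_divide_less_eq)
      also have "\<dots> \<le> real (Suc N) * e\<^sup>2"
        by (intro mult_right_mono) auto
      finally show ?thesis by (simp only: mult.commute)
    qed
    then have N: "4 * (2 * d + 1) / real (Suc N) < e\<^sup>2"
      by (subst pos_divide_less_eq) auto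
    have "dist (w m) (w n) < e" if "N \<le> m" "N \<le> n" for m n
    proof -
      have "(norm (w m - w n))\<^sup>2 < e\<^sup>2"
        using par[OF that] N by linarith
      then show ?thesis
        using e power_less_imp_less_base[of "norm (w m - w n)" 2 e] by (simp add: dist_norm)
    qed
    then show "\<exists>N. \<forall>m\<ge>N. \<forall>n\<ge>N. dist (w m) (w n) < e" by blast
  qed
  then obtain v where v: "w \<longlonglongrightarrow> v"
    using Cauchy_convergent convergent_def by blast
  have vV: "v \<in> V"
    using closed_sequentially[OF V w(1) v] .
  have "(\<lambda>n. norm (x - w n)) \<longlonglongrightarrow> norm (x - v)"
    using v by (intro tendsto_intros)
  moreover have "(\<lambda>n. d + 1 / real (Suc n)) \<longlonglongrightarrow> d + 0"
    by (intro tendsto_intros LIMSEQ_Suc lim_1_over_n)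
  ultimately have "norm (x - v) \<le> d + 0"
    by (rule LIMSEQ_le) (use w(2) less_imp_le in blast)
  then have xv: "norm (x - v) = d" using dle[OF vV] by simp
  have orth: "inner (x - v) u = 0" if u: "u \<in> V" for u
  proof (cases "u = 0")
    case False
    define t where "t = inner (x - v) u / (norm u)\<^sup>2"
    have "d \<le> norm (x - (v + t *\<^sub>R u))"
      using dle add[OF vV scale[OF u]] by blast
    then have "d\<^sup>2 \<le> (norm ((x - v) - t *\<^sub>R u))\<^sup>2"
      using d by (intro power_mono) (auto simp: algebra_simps)
    also have "\<dots> = d\<^sup>2 - 2 * t * inner (x - v) u + t\<^sup>2 * (norm u)\<^sup>2"
      unfolding xv[symmetric] power2_norm_eq_inner
      by (simp add: inner_diff_left inner_diff_right inner_commute power2_eq_square algebra_simps)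
    also have "\<dots> = d\<^sup>2 - (inner (x - v) u)\<^sup>2 / (norm u)\<^sup>2"
      using False by (simp add: t_def power2_eq_square divide_simps)
    finally have "(inner (x - v) u)\<^sup>2 / (norm u)\<^sup>2 \<le> 0" by simp
    then show ?thesis
      using False by (simp add: divide_le_0_iff)
  qed simp
  show ?thesis
    by (rule that[of "x - v"]) (use orth x vV in auto)
qed

text \<open>
  A vector orthogonal to the whole family has zero energy, so the lower frame bound makes it
  vanish; hence the closed span has no nonzero orthogonal vector and is the whole space.
\<close>

lemma frame_imp_complete_family:
  fixes f :: "'g \<Rightarrow> 'a::complex_hilbert_space"
  assumes "is_frame G f"
  shows "is_complete_family G f"
proof (rule ccontr)
  define V where "V = closure (cspan (f ` G))"
  assume "\<not> is_complete_family G f"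
  then obtain x where x: "x \<notin> V"
    by (auto simp: is_complete_family_def V_def)
  have "closed V" by (simp add: V_def)
  moreover have sub: "cspan (f ` G) \<subseteq> V" by (simp add: V_def closure_subset)
  moreover have "0 \<in> V" using sub complex_vector.span_zero by blast
  moreover have "u + v \<in> V" if uv: "u \<in> V" "v \<in> V" for u v
  proof -
    obtain s t where "\<And>n. s n \<in> cspan (f ` G)" "s \<longlonglongrightarrow> u" "\<And>n. t n \<in> cspan (f ` G)" "t \<longlonglongrightarrow> v"
      using uv unfolding V_def closure_sequential by blast
    then have "\<forall>n. s n + t n \<in> cspan (f ` G)" "(\<lambda>n. s n + t n) \<longlonglongrightarrow> u + v"
      by (auto intro: complex_vector.span_add tendsto_add)
    then show ?thesis
      unfolding V_def closure_sequential by (intro exI[of _ "\<lambda>n. s n + t n"]) blast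
  qed
  moreover have "r *\<^sub>R v \<in> V" if v: "v \<in> V" for r v
  proof -
    obtain s where "\<And>n. s n \<in> cspan (f ` G)" "s \<longlonglongrightarrow> v"
      using v unfolding V_def closure_sequential by blast
    then have "\<forall>n. r *\<^sub>R s n \<in> cspan (f ` G)" "(\<lambda>n. r *\<^sub>R s n) \<longlonglongrightarrow> r *\<^sub>R v"
      by (auto simp: scaleR_scaleC[of r] intro: complex_vector.span_scale)
        (simp add: scaleC_of_real tendsto_scaleR)
    then show ?thesis
      unfolding V_def closure_sequential by (intro exI[of _ "\<lambda>n. r *\<^sub>R s n"]) blast
  qed
  ultimately obtain y where y: "y \<noteq> 0" "\<And>v. v \<in> V \<Longrightarrow> inner y v = 0"
    using closed_subspace_orthogonal_vector x by metis
  have "cinner y (f g) = 0" if "g \<in> G" for g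
  proof (rule complex_eqI)
    have f: "f g \<in> cspan (f ` G)" using that by (simp add: complex_vector.span_base)
    then show "Re (cinner y (f g)) = Re 0"
      using y(2) sub by (auto simp: inner_eq_Re_cinner)
    have "\<i> *\<^sub>C f g \<in> V" using f sub complex_vector.span_scale by blast
    then show "Im (cinner y (f g)) = Im 0"
      using y(2)[of "\<i> *\<^sub>C f g"] by (simp add: inner_eq_Re_cinner cinner_scaleC_right)
  qed
  then have "(\<Sum>\<^sub>\<infinity>g\<in>G. (cmod (cinner y (f g)))\<^sup>2) = 0"
    by (intro infsum_0) simp
  moreover obtain a where "a > 0" "a * (norm y)\<^sup>2 \<le> (\<Sum>\<^sub>\<infinity>g\<in>G. (cmod (cinner y (f g)))\<^sup>2)"
    using assms unfolding is_frame_def by blast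
  ultimately show False using y(1) by (simp add: mult_le_0_iff)
qed
section \<open>Energy of the frame coefficients\<close>

definition coeff_energy :: "'g set \<Rightarrow> ('g \<Rightarrow> 'a::complex_inner) \<Rightarrow> 'a \<Rightarrow> real"
  where "coeff_energy G f x = (\<Sum>\<^sub>\<infinity>g\<in>G. (cmod (cinner x (f g)))\<^sup>2)"

definition bessel_family :: "'g set \<Rightarrow> ('g \<Rightarrow> 'a::complex_inner) \<Rightarrow> real \<Rightarrow> bool"
  where "bessel_family G f b \<longleftrightarrow>
    (\<forall>x. (\<lambda>g. (cmod (cinner x (f g)))\<^sup>2) summable_on G \<and> coeff_energy G f x \<le> b * (norm x)\<^sup>2)"

lemma is_frame_iff_bessel:
  "is_frame G f \<longleftrightarrow> countable G \<and>
    (\<exists>a>0. \<exists>b. bessel_family G f b \<and> (\<forall>x. a * (norm x)\<^sup>2 \<le> coeff_energy G f x))"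
proof
  assume "is_frame G f"
  then show "countable G \<and>
      (\<exists>a>0. \<exists>b. bessel_family G f b \<and> (\<forall>x. a * (norm x)\<^sup>2 \<le> coeff_energy G f x))"
    unfolding is_frame_def bessel_family_def coeff_energy_def by blast
next
  assume "countable G \<and>
      (\<exists>a>0. \<exists>b. bessel_family G f b \<and> (\<forall>x. a * (norm x)\<^sup>2 \<le> coeff_energy G f x))"
  then obtain a b where *: "countable G" "a > 0" "bessel_family G f b"
      "\<And>x. a * (norm x)\<^sup>2 \<le> coeff_energy G f x"
    by blast
  have "coeff_energy G f x \<le> max a b * (norm x)\<^sup>2" for x
  proof -
    have "coeff_energy G f x \<le> b * (norm x)\<^sup>2"
      using *(3) by (simp add: bessel_family_def)
    also have "\<dots> \<le> max a b * (norm x)\<^sup>2"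
      by (rule mult_right_mono) auto
    finally show ?thesis .
  qed
  then show "is_frame G f"
    using * unfolding is_frame_def bessel_family_def coeff_energy_def
    by (intro conjI exI[of _ a] exI[of _ "max a b"]) auto
qed

lemma coeff_energy_nonneg: "coeff_energy G f x \<ge> 0"
  unfolding coeff_energy_def by (rule infsum_nonneg) simp

lemma coeff_energy_scaleR: "coeff_energy G f (r *\<^sub>R x) = r\<^sup>2 * coeff_energy G f x"
  unfolding coeff_energy_def
  by (simp add: scaleR_scaleC cinner_scaleC_left norm_mult power_mult_distrib infsum_cmult_right')

lemma coeff_energy_add_le:
  assumes "bessel_family G f b"
  shows "coeff_energy G f (x + y) \<le> 2 * coeff_energy G f x + 2 * coeff_energy G f y"
proof -
  have s: "(\<lambda>g. (cmod (cinner z (f g)))\<^sup>2) summable_on G" for z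
    using assms by (simp add: bessel_family_def)
  have "coeff_energy G f (x + y)
      \<le> (\<Sum>\<^sub>\<infinity>g\<in>G. 2 * (cmod (cinner x (f g)))\<^sup>2 + 2 * (cmod (cinner y (f g)))\<^sup>2)"
    unfolding coeff_energy_def
  proof (rule infsum_mono[OF s])
    show "(\<lambda>g. 2 * (cmod (cinner x (f g)))\<^sup>2 + 2 * (cmod (cinner y (f g)))\<^sup>2) summable_on G"
      by (intro summable_on_add summable_on_cmult_right s)
    fix g
    have "(cmod (cinner (x + y) (f g)))\<^sup>2 \<le> (cmod (cinner x (f g)) + cmod (cinner y (f g)))\<^sup>2"
      by (intro power_mono) (simp_all add: cinner_add_left norm_triangle_ineq)
    also have "\<dots> \<le> 2 * (cmod (cinner x (f g)))\<^sup>2 + 2 * (cmod (cinner y (f g)))\<^sup>2"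
      using sum_squares_bound[of "cmod (cinner x (f g))" "cmod (cinner y (f g))"]
      by (simp add: power2_sum)
    finally show "(cmod (cinner (x + y) (f g)))\<^sup>2
        \<le> 2 * (cmod (cinner x (f g)))\<^sup>2 + 2 * (cmod (cinner y (f g)))\<^sup>2" .
  qed
  also have "\<dots> = 2 * coeff_energy G f x + 2 * coeff_energy G f y"
    unfolding coeff_energy_def
    by (simp add: infsum_add summable_on_cmult_right s infsum_cmult_right')
  finally show ?thesis .
qed

lemma coeff_energy_subfamily:
  assumes f: "bessel_family G f b" and h: "inj_on h G'" "h ` G' \<subseteq> G"
    and k: "\<And>g. g \<in> G' \<Longrightarrow> k g = f (h g)"
  shows coeff_energy_subfamily_le: "coeff_energy G' k x \<le> coeff_energy G f x"
    and bessel_subfamily: "bessel_family G' k b"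
proof -
  have s: "(\<lambda>g. (cmod (cinner x (f g)))\<^sup>2) summable_on G" for x
    using f by (simp add: bessel_family_def)
  have s': "(\<lambda>g. (cmod (cinner x (f g)))\<^sup>2) summable_on h ` G'" for x
    using summable_on_subset[OF s h(2)] .
  have e: "coeff_energy G' k x = (\<Sum>\<^sub>\<infinity>g\<in>h ` G'. (cmod (cinner x (f g)))\<^sup>2)" for x
    unfolding coeff_energy_def infsum_reindex[OF h(1)] o_def
    by (rule infsum_cong) (simp add: k)
  show le: "coeff_energy G' k x \<le> coeff_energy G f x" for x
    unfolding e unfolding coeff_energy_def by (rule infsum_mono2[OF s' s h(2)]) simp
  have "(\<lambda>g. (cmod (cinner x (k g)))\<^sup>2) summable_on G'" for x
    using s'[of x] unfolding summable_on_reindex[OF h(1)] o_def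
    by (subst summable_on_cong[where g = "\<lambda>g. (cmod (cinner x (f (h g))))\<^sup>2"]) (simp_all add: k)
  then show "bessel_family G' k b"
    using f le unfolding bessel_family_def by (meson order_trans)
qed

section \<open>Subsampling the orbits of a positive operator\<close>

text \<open>
  Up to an arbitrarily small multiple of \<open>\<parallel>x\<parallel>\<^sup>2\<close>, the energy of \<open>A x\<close> is controlled by that
  of \<open>x\<close> as soon as the energy does not grow under \<open>A^q\<close>: a polynomial in \<open>A^q\<close> increases it
  at most by a constant factor, and \<open>A\<close> differs from such a polynomial by an operator of small norm.
\<close>

lemma coeff_energy_root_estimate:
  fixes A :: "'a::complex_inner \<Rightarrow> 'a"
  assumes A: "positive_op A" and q: "q > 0" and f: "bessel_family G f b"
    and mono: "\<And>x. coeff_energy G f ((A ^^ q) x) \<le> coeff_energy G f x"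
    and e: "e > 0"
  shows "\<exists>C\<ge>0. \<forall>x. coeff_energy G f (A x) \<le> C * coeff_energy G f x + e * (norm x)\<^sup>2"
proof -
  define E where "E = coeff_energy G f"
  \<comment> \<open>The error \<open>\<eta> \<parallel>x\<parallel>\<close> in norm costs \<open>2 b \<eta>\<^sup>2 \<parallel>x\<parallel>\<^sup>2\<close> in energy; the summand \<open>1\<close> covers \<open>b = 0\<close>.\<close>
  define \<eta> where "\<eta> = sqrt (e / (2 * (\<bar>b\<bar> + 1)))"
  have eta: "\<eta> > 0" "2 * \<bar>b\<bar> * \<eta>\<^sup>2 \<le> e"
    using e by (simp_all add: \<eta>_def field_simps)
  obtain a :: "nat \<Rightarrow> real" and n
    where a: "\<And>x. norm (A x - (\<Sum>i\<le>n. a i *\<^sub>R (A ^^ (q * i)) x)) \<le> \<eta> * norm x"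
    using positive_op_approx_by_poly_of_power[OF A q eta(1)] by blast
  have add: "E (x + y) \<le> 2 * E x + 2 * E y" for x y
    unfolding E_def using f by (rule coeff_energy_add_le)
  have pow: "E ((A ^^ (q * i)) x) \<le> E x" for i x
  proof (induction i)
    case (Suc i)
    have "(A ^^ (q * Suc i)) x = (A ^^ q) ((A ^^ (q * i)) x)"
      by (simp add: funpow_add)
    then show ?case using mono[of "(A ^^ (q * i)) x"] Suc by (simp add: E_def)
  qed simp
  have "\<exists>C\<ge>0. \<forall>x. E (\<Sum>i\<le>m. a i *\<^sub>R (A ^^ (q * i)) x) \<le> C * E x" for m
  proof (induction m)
    case 0
    show ?case
      by (intro exI[of _ "(a 0)\<^sup>2"]) (simp add: E_def coeff_energy_scaleR)
  next
    case (Suc m)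
    then obtain C where C: "C \<ge> 0" "\<And>x. E (\<Sum>i\<le>m. a i *\<^sub>R (A ^^ (q * i)) x) \<le> C * E x"
      by blast
    have "E (\<Sum>i\<le>Suc m. a i *\<^sub>R (A ^^ (q * i)) x) \<le> (2 * C + 2 * (a (Suc m))\<^sup>2) * E x" for x
    proof -
      have "E (\<Sum>i\<le>Suc m. a i *\<^sub>R (A ^^ (q * i)) x)
          \<le> 2 * E (\<Sum>i\<le>m. a i *\<^sub>R (A ^^ (q * i)) x) + 2 * E (a (Suc m) *\<^sub>R (A ^^ (q * Suc m)) x)"
        unfolding sum.atMost_Suc by (rule add)
      also have "\<dots> \<le> 2 * (C * E x) + 2 * ((a (Suc m))\<^sup>2 * E x)"
        using C(2)[of x] mult_left_mono[OF pow[of "Suc m" x], of "(a (Suc m))\<^sup>2"]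
        by (simp add: E_def coeff_energy_scaleR)
      finally show ?thesis by (simp add: algebra_simps)
    qed
    then show ?case
      using C(1) by (intro exI[of _ "2 * C + 2 * (a (Suc m))\<^sup>2"]) auto
  qed
  then obtain C where C: "C \<ge> 0" "\<And>x. E (\<Sum>i\<le>n. a i *\<^sub>R (A ^^ (q * i)) x) \<le> C * E x"
    by blast
  have "E (A x) \<le> 2 * C * E x + e * (norm x)\<^sup>2" for x
  proof -
    define p where "p = (\<Sum>i\<le>n. a i *\<^sub>R (A ^^ (q * i)) x)"
    have "E (A x - p) \<le> b * (norm (A x - p))\<^sup>2"
      using f by (simp add: bessel_family_def E_def)
    also have "\<dots> \<le> \<bar>b\<bar> * (\<eta> * norm x)\<^sup>2"
      using power_mono[OF a[of x] norm_ge_zero, of 2]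
      by (intro mult_mono) (auto simp: p_def)
    finally have "2 * E (A x - p) \<le> (2 * \<bar>b\<bar> * \<eta>\<^sup>2) * (norm x)\<^sup>2"
      by (simp add: power_mult_distrib)
    also have "\<dots> \<le> e * (norm x)\<^sup>2"
      by (rule mult_right_mono[OF eta(2)]) simp
    finally have "2 * E (A x - p) \<le> e * (norm x)\<^sup>2" .
    moreover have "E (A x) \<le> 2 * E p + 2 * E (A x - p)"
      using add[of p "A x - p"] by simp
    ultimately show ?thesis using C(2)[of x] by (simp add: p_def)
  qed
  then show ?thesis
    using C(1) unfolding E_def by (intro exI[of _ "2 * C"]) auto
qed

lemma coeff_energy_power_estimate:
  fixes A :: "'a::complex_inner \<Rightarrow> 'a"
  assumes A: "positive_op A" and q: "q > 0" and f: "bessel_family G f b"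
    and mono: "\<And>x. coeff_energy G f ((A ^^ q) x) \<le> coeff_energy G f x"
    and e: "e > 0"
  shows "\<exists>C\<ge>0. \<forall>x. coeff_energy G f ((A ^^ r) x) \<le> C * coeff_energy G f x + e * (norm x)\<^sup>2"
  using e
proof (induction r arbitrary: e)
  case 0
  then show ?case by (intro exI[of _ 1]) simp
next
  case (Suc r)
  have "bounded_linear A" using A by (simp add: positive_op_def bounded_clinear_def)
  then obtain M where M: "M > 0" "\<And>x. norm (A x) \<le> M * norm x"
    using bounded_linear.pos_bounded[of A] by (auto simp: mult.commute)
  \<comment> \<open>This estimate is used at \<open>A x\<close>, which inflates its error by \<open>M\<^sup>2\<close>; the next error gets multiplied by \<open>C\<close>.\<close>
  obtain C where C: "C \<ge> 0"
      "\<And>x. coeff_energy G f ((A ^^ r) x) \<le> C * coeff_energy G f x + e / (2 * M\<^sup>2) * (norm x)\<^sup>2"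
    using Suc.IH[of "e / (2 * M\<^sup>2)"] Suc.prems M(1) by auto
  obtain D where D: "D \<ge> 0"
      "\<And>x. coeff_energy G f (A x) \<le> D * coeff_energy G f x + e / (2 * (C + 1)) * (norm x)\<^sup>2"
    using coeff_energy_root_estimate[OF A q f mono, of "e / (2 * (C + 1))"] Suc.prems C(1) by auto
  have "coeff_energy G f ((A ^^ Suc r) x) \<le> C * D * coeff_energy G f x + e * (norm x)\<^sup>2" for x
  proof -
    have "coeff_energy G f ((A ^^ Suc r) x) = coeff_energy G f ((A ^^ r) (A x))"
      by (simp add: funpow_swap1)
    also have "\<dots> \<le> C * coeff_energy G f (A x) + e / (2 * M\<^sup>2) * (norm (A x))\<^sup>2"
      by (rule C(2))
    also have "C * coeff_energy G f (A x)
        \<le> C * (D * coeff_energy G f x + e / (2 * (C + 1)) * (norm x)\<^sup>2)"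
      by (rule mult_left_mono[OF D(2) C(1)])
    also have "\<dots> = C * D * coeff_energy G f x + C * (e / (2 * (C + 1))) * (norm x)\<^sup>2"
      by (simp add: algebra_simps)
    also have "C * (e / (2 * (C + 1))) * (norm x)\<^sup>2 \<le> e / 2 * (norm x)\<^sup>2"
      using C(1) Suc.prems by (intro mult_right_mono) (simp_all add: field_simps)
    also have "e / (2 * M\<^sup>2) * (norm (A x))\<^sup>2 \<le> e / (2 * M\<^sup>2) * (M * norm x)\<^sup>2"
      using Suc.prems M by (intro mult_left_mono power_mono) auto
    also have "\<dots> = e / 2 * (norm x)\<^sup>2"
      using M(1) by (simp add: power_mult_distrib)
    finally show ?thesis by simp
  qed
  then show ?case using C(1) D(1) by (intro exI[of _ "C * D"]) auto
qed

lemma cinner_funpow_self_adjoint: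
  assumes "self_adjoint A"
  shows "cinner ((A ^^ n) x) y = cinner x ((A ^^ n) y)"
  using assms by (induction n arbitrary: x) (simp_all add: self_adjoint_def funpow_swap1)

text \<open>
  Write each exponent as \<open>q m + r\<close> with \<open>r < q\<close> and move \<open>A^r\<close> to the other side of the inner
  product.
\<close>

lemma coeff_energy_orbit_residues:
  fixes A :: "'a::complex_inner \<Rightarrow> 'a"
  assumes A: "self_adjoint A" and q: "q > 0"
    and f: "bessel_family (UNIV \<times> I) (\<lambda>(n::nat, i). (A ^^ n) (f i)) b"
  shows "coeff_energy (UNIV \<times> I) (\<lambda>(n::nat, i). (A ^^ n) (f i)) x
       = (\<Sum>r<q. coeff_energy (UNIV \<times> I) (\<lambda>(n::nat, i). (A ^^ (q * n)) (f i)) ((A ^^ r) x))"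
proof -
  define t where "t = (\<lambda>(n::nat, i). (cmod (cinner x ((A ^^ n) (f i))))\<^sup>2)"
  define s where "s = (\<lambda>(r, m, i). t (q * m + r, i))"
  have t: "t summable_on UNIV \<times> I"
    using f unfolding bessel_family_def t_def by (simp add: case_prod_beta')
  have bij: "bij_betw (\<lambda>(r, m, i). (q * m + r, i)) ({..<q} \<times> (UNIV \<times> I)) (UNIV \<times> I)"
    by (rule bij_betwI[where g = "\<lambda>(n, i). (n mod q, n div q, i)"]) (use q in auto)
  have s: "s = (\<lambda>u. t ((\<lambda>(r, m, i). (q * m + r, i)) u))"
    by (auto simp: s_def)
  have "s summable_on {..<q} \<times> (UNIV \<times> I)"
    unfolding s summable_on_reindex_bij_betw[OF bij] by (rule t)
  then have "infsum s ({..<q} \<times> (UNIV \<times> I))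
      = (\<Sum>\<^sub>\<infinity>r\<in>{..<q}. \<Sum>\<^sub>\<infinity>u\<in>UNIV \<times> I. s (r, u))"
    by (rule infsum_Sigma_banach[symmetric])
  also have "\<dots> = (\<Sum>r<q. \<Sum>\<^sub>\<infinity>u\<in>UNIV \<times> I. s (r, u))"
    by simp
  also have "\<dots> = (\<Sum>r<q. coeff_energy (UNIV \<times> I) (\<lambda>(n::nat, i). (A ^^ (q * n)) (f i)) ((A ^^ r) x))"
    unfolding coeff_energy_def
    by (intro sum.cong infsum_cong refl)
      (auto simp: s_def t_def cinner_funpow_self_adjoint[OF A] add.commute funpow_add)
  finally show ?thesis
    unfolding s infsum_reindex_bij_betw[OF bij]
    by (simp add: coeff_energy_def t_def case_prod_beta')
qed

text \<open>
  Only the lower bound needs an argument. The energy of the full orbit is a sum of the subsampled energies of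
  \<open>x, A x, \<dots>, A^(q-1) x\<close>, each of which is at most \<open>C\<close> times the subsampled energy of \<open>x\<close> plus
  an error; choosing all errors together below half of the lower frame bound lets them be absorbed.
\<close>

lemma positive_orbit_frame_subsample:
  fixes A :: "'a::complex_inner \<Rightarrow> 'a" and f :: "'i \<Rightarrow> 'a"
  assumes A: "positive_op A" and q: "q > 0"
    and frame: "is_frame (UNIV \<times> I) (\<lambda>(n::nat, i). (A ^^ n) (f i))"
  shows "is_frame (UNIV \<times> I) (\<lambda>(n::nat, i). (A ^^ (q * n)) (f i))"
proof -
  define G :: "(nat \<times> 'i) set" where "G = UNIV \<times> I"
  define F where "F = coeff_energy G (\<lambda>(n::nat, i). (A ^^ n) (f i))"
  define k where "k = (\<lambda>(n::nat, i). (A ^^ (q * n)) (f i))"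
  obtain a b where G: "countable G" and a: "a > 0" "\<And>x. a * (norm x)\<^sup>2 \<le> F x"
    and b: "bessel_family G (\<lambda>(n::nat, i). (A ^^ n) (f i)) b"
    using frame unfolding is_frame_iff_bessel F_def G_def by blast
  have sa: "self_adjoint A" using A by (simp add: positive_op_def)
  have kb: "bessel_family G k b"
    by (rule bessel_subfamily[OF b, where h = "\<lambda>(n, i). (q * n, i)"])
      (use q in \<open>auto simp: inj_on_def G_def k_def\<close>)
  have mono: "coeff_energy G k ((A ^^ q) x) \<le> coeff_energy G k x" for x
  proof -
    have "coeff_energy G k ((A ^^ q) x) = coeff_energy G (\<lambda>(n, i). k (Suc n, i)) x"
      unfolding coeff_energy_def
      by (intro infsum_cong) (auto simp: k_def cinner_funpow_self_adjoint[OF sa] funpow_add)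
    also have "\<dots> \<le> coeff_energy G k x"
      by (rule coeff_energy_subfamily_le[OF kb, where h = "\<lambda>(n, i). (Suc n, i)"])
        (auto simp: inj_on_def G_def)
    finally show ?thesis .
  qed
  define e where "e = a / (2 * real q)"
  have e: "e > 0" using a q by (simp add: e_def)
  have "\<exists>C. \<forall>r. C r \<ge> 0 \<and>
      (\<forall>x. coeff_energy G k ((A ^^ r) x) \<le> C r * coeff_energy G k x + e * (norm x)\<^sup>2)"
    using coeff_energy_power_estimate[OF A q kb mono e] by (intro choice) blast
  then obtain C where C: "\<And>r. C r \<ge> 0"
      "\<And>r x. coeff_energy G k ((A ^^ r) x) \<le> C r * coeff_energy G k x + e * (norm x)\<^sup>2"
    by blast
  define D where "D = (\<Sum>r<q. C r) + 1"
  have D: "D > 0" using C(1) by (simp add: D_def sum_nonneg add_nonneg_pos)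
  have "a / (2 * D) * (norm x)\<^sup>2 \<le> coeff_energy G k x" for x
  proof -
    have "a * (norm x)\<^sup>2 \<le> (\<Sum>r<q. coeff_energy G k ((A ^^ r) x))"
      using a(2)[of x] coeff_energy_orbit_residues[OF sa q b[unfolded G_def], of x]
      by (simp add: F_def G_def k_def)
    also have "\<dots> \<le> (\<Sum>r<q. C r * coeff_energy G k x + e * (norm x)\<^sup>2)"
      by (intro sum_mono C(2))
    also have "\<dots> = (\<Sum>r<q. C r) * coeff_energy G k x + a / 2 * (norm x)\<^sup>2"
      using q by (simp add: sum.distrib sum_distrib_right e_def)
    also have "\<dots> \<le> D * coeff_energy G k x + a / 2 * (norm x)\<^sup>2"
      using coeff_energy_nonneg[of G k x] by (simp add: D_def algebra_simps)
    finally show ?thesis using D by (simp add: field_simps)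
  qed
  moreover have "a / (2 * D) > 0" using a(1) D by simp
  ultimately show ?thesis
    using G kb unfolding is_frame_iff_bessel G_def k_def by blast
qed

section \<open>Removing elements\<close>

text \<open>
  Keeping only the even powers removes infinitely many elements and leaves a frame, which is
  complete.
\<close>

lemma positive_orbit_frame_infinite_excess:
  fixes A :: "'a::complex_hilbert_space \<Rightarrow> 'a" and f :: "'i \<Rightarrow> 'a"
  assumes dim: "infinite_dimensional TYPE('a)" and A: "positive_op A"
    and frame: "is_frame (UNIV \<times> I) (\<lambda>(n::nat, i). (A ^^ n) (f i))"
  shows "excess (UNIV \<times> I) (\<lambda>(n::nat, i). (A ^^ n) (f i)) = \<infinity>"
proof -
  define \<phi> where "\<phi> = (\<lambda>(n::nat, i). (A ^^ n) (f i))"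
  define J where "J = {n::nat. odd n} \<times> I"
  have "is_complete_family (UNIV \<times> I) (\<lambda>(n::nat, i). (A ^^ (2 * n)) (f i))"
    by (intro frame_imp_complete_family positive_orbit_frame_subsample A frame) simp
  moreover have "(\<lambda>(n::nat, i). (A ^^ (2 * n)) (f i)) ` (UNIV \<times> I) = \<phi> ` (UNIV \<times> I - J)"
    by (force simp: \<phi>_def J_def image_iff elim!: evenE)
  ultimately have "is_complete_family (UNIV \<times> I - J) \<phi>"
    by (simp add: is_complete_family_def)
  moreover have "J \<subseteq> UNIV \<times> I" by (auto simp: J_def)
  ultimately have "ecard J \<le> excess (UNIV \<times> I) \<phi>"
    unfolding excess_def by (intro SUP_upper) simp
  moreover have "infinite J"
  proof -
    have "I \<noteq> {}"
    proof
      \<comment> \<open>The empty family spans \<open>{0}\<close>, so its completeness would make the space trivial.\<close>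
      assume "I = {}"
      then have "closure (cspan ({}::'a set)) = UNIV"
        using frame_imp_complete_family[OF frame] by (simp add: is_complete_family_def)
      then have "cspan ({}::'a set) = UNIV" by simp
      then show False using dim unfolding infinite_dimensional_def by blast
    qed
    moreover have "infinite {n::nat. odd n}"
      unfolding infinite_nat_iff_unbounded_le
    proof
      fix m :: nat
      show "\<exists>n\<ge>m. n \<in> {n. odd n}" by (intro exI[of _ "Suc (2 * m)"]) simp
    qed
    ultimately show ?thesis
      unfolding J_def using finite_cartesian_productD1 by blast
  qed
  ultimately show ?thesis by (simp add: ecard_def \<phi>_def)
qed

lemma invertible_op_funpow_bounded_below:
  fixes A :: "'a::complex_inner \<Rightarrow> 'a"
  assumes "invertible_op A"
  shows "\<exists>c>0. \<forall>x. c * norm x \<le> norm ((A ^^ n) x)"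
proof -
  obtain B where B: "bounded_linear B" "\<And>x. B (A x) = x"
    using assms unfolding invertible_op_def bounded_clinear_def by (metis comp_apply id_apply)
  then obtain K where K: "K > 0" "\<And>x. norm (B x) \<le> norm x * K"
    using bounded_linear.pos_bounded by blast
  have "(1 / K) ^ n * norm x \<le> norm ((A ^^ n) x)" for x
  proof (induction n)
    case (Suc n)
    have "(1 / K) ^ Suc n * norm x \<le> 1 / K * norm ((A ^^ n) x)"
      using Suc K(1) by (simp add: divide_right_mono)
    also have "\<dots> \<le> norm ((A ^^ Suc n) x)"
      using K(2)[of "A ((A ^^ n) x)"] K(1) by (simp add: B(2) field_simps)
    finally show ?case .
  qed simp
  then show ?thesis using K(1) by (intro exI[of _ "(1 / K) ^ n"]) auto
qed

text \<open>
  The removed indices all have \<open>n < N\<close> for some \<open>N\<close>, and the energy of \<open>x\<close> along the tail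
  \<open>n \<ge> N\<close> is the full energy of \<open>A^N x\<close>, which is bounded below because \<open>A\<close> is.
\<close>

lemma invertible_orbit_frame_remove_finite:
  fixes A :: "'a::complex_inner \<Rightarrow> 'a" and f :: "'i \<Rightarrow> 'a"
  assumes A: "self_adjoint A" "invertible_op A" and J: "finite J"
    and frame: "is_frame (UNIV \<times> I) (\<lambda>(n::nat, i). (A ^^ n) (f i))"
  shows "is_frame (UNIV \<times> I - J) (\<lambda>(n::nat, i). (A ^^ n) (f i))"
proof -
  define G :: "(nat \<times> 'i) set" where "G = UNIV \<times> I"
  define \<phi> where "\<phi> = (\<lambda>(n::nat, i). (A ^^ n) (f i))"
  obtain a b where G: "countable G" and a: "a > 0" "\<And>x. a * (norm x)\<^sup>2 \<le> coeff_energy G \<phi> x"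
    and b: "bessel_family G \<phi> b"
    using frame unfolding is_frame_iff_bessel G_def \<phi>_def by blast
  obtain N where N: "\<And>n i. (n, i) \<in> J \<Longrightarrow> n < N"
    using finite_imageI[OF J, of fst] by (force simp: finite_nat_set_iff_bounded)
  obtain c where c: "c > 0" "\<And>x. c * norm x \<le> norm ((A ^^ N) x)"
    using invertible_op_funpow_bounded_below[OF A(2)] by blast
  have bJ: "bessel_family (G - J) \<phi> b"
    by (rule bessel_subfamily[OF b, where h = id]) auto
  have "a * c\<^sup>2 * (norm x)\<^sup>2 \<le> coeff_energy (G - J) \<phi> x" for x
  proof -
    have "a * c\<^sup>2 * (norm x)\<^sup>2 \<le> a * (norm ((A ^^ N) x))\<^sup>2"
      using power_mono[OF c(2)[of x], of 2] a(1) c(1)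
      by (simp add: power_mult_distrib mult.assoc)
    also have "\<dots> \<le> coeff_energy G \<phi> ((A ^^ N) x)"
      by (rule a(2))
    also have "\<dots> = coeff_energy G (\<lambda>(n, i). \<phi> (N + n, i)) x"
      unfolding coeff_energy_def
      by (intro infsum_cong) (auto simp: \<phi>_def cinner_funpow_self_adjoint[OF A(1)] funpow_add)
    also have "\<dots> \<le> coeff_energy (G - J) \<phi> x"
      by (rule coeff_energy_subfamily_le[OF bJ, where h = "\<lambda>(n, i). (N + n, i)"])
        (use N in \<open>fastforce simp: inj_on_def G_def\<close>)+
    finally show ?thesis .
  qed
  moreover have "a * c\<^sup>2 > 0" using a(1) c(1) by simp
  moreover have "countable (G - J)" using G by (rule countable_Diff)
  ultimately show ?thesis
    using bJ unfolding is_frame_iff_bessel G_def \<phi>_def by blast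
qed

theorem corollary4p4:
  fixes A :: "'a::complex_hilbert_space \<Rightarrow> 'a"
    and I :: "'i set"
    and f :: "'i \<Rightarrow> 'a"
  assumes "infinite_dimensional TYPE('a)"
    and "separable_space (euclidean :: 'a topology)"
    and "positive_op A"
    and "finite I"
    and "is_frame (UNIV \<times> I) (\<lambda>(n::nat, i). (A ^^ n) (f i))"
  shows "(\<forall>q::nat. q > 0 \<longrightarrow> is_frame (UNIV \<times> I) (\<lambda>(n::nat, i). (A ^^ (q * n)) (f i)))
    \<and> excess (UNIV \<times> I) (\<lambda>(n::nat, i). (A ^^ n) (f i)) = \<infinity>
    \<and> (invertible_op A \<longrightarrow>
        (\<forall>J \<subseteq> UNIV \<times> I. finite J \<longrightarrow>
          is_frame (UNIV \<times> I - J) (\<lambda>(n::nat, i). (A ^^ n) (f i))))"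
proof (intro conjI allI impI)
  fix q :: nat
  assume "q > 0"
  then show "is_frame (UNIV \<times> I) (\<lambda>(n::nat, i). (A ^^ (q * n)) (f i))"
    using positive_orbit_frame_subsample assms(3,5) by blast
next
  show "excess (UNIV \<times> I) (\<lambda>(n::nat, i). (A ^^ n) (f i)) = \<infinity>"
    using assms(1,3,5) by (rule positive_orbit_frame_infinite_excess)
next
  fix J :: "(nat \<times> 'i) set"
  assume "invertible_op A" "finite J"
  moreover have "self_adjoint A" using assms(3) by (simp add: positive_op_def)
  ultimately show "is_frame (UNIV \<times> I - J) (\<lambda>(n::nat, i). (A ^^ n) (f i))"
    using invertible_orbit_frame_remove_finite assms(5) by blast
qed
end
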